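(* Let $(X,\rho)$ be a compact metric space with diameter $\pi$. Let $r\in\mathbb{N}$ and $0=t_0<t_1<\cdots<t_\ell=\pi$. Let $\Phi\in C[0,\pi]$ satisfy $$|\Phi(s)-\Phi(s')|\le |s-s'|\quad\text{for all } s,s'\in[0,\pi],$$ and belong to the class $\mathcal{S}_r(t_1,\dots,t_\ell)$ (for the space $(X,\rho)$). Let $\beta\ge 1$, $c_1>1$, $c_2>1$ be constants, and let $\mu$ be a Borel probability measure on $X$ satisfying the following two conditions: (a) for each positive integer $N$ there exists a partition $\{X_1,\dots,X_N\}$ of $X$ such that $\mu(X_j)=\frac1N$ and $\operatorname{diam}(X_j)\le c_1N^{-1/\beta}$ for $1\le j\le N$; (b) for each $x\in X$, each $\delta\in(0,\pi)$ and each $1\le j<\ell$, $\ \mu\bigl(E(x;t_j-\delta,t_j+\delta)\bigr)\le c_2\delta$. Then for each integer $N\ge 4$ there exist points $y_1,\dots,y_{(r+2)N}\in X$ and nonnegative numbers $\lambda_1,\dots,\lambda_{(r+2)N}\ge 0$ such that $\sum_{j=1}^{(r+2)N}\lambda_j=1$ and $$\max_{x\in X}\left|\int_X\Phi(\rho(x,y))\,d\mu(y)-\sum_{j=1}^{(r+2)N}\lambda_j\Phi(\rho(x,y_j))\right|\le c_3\,N^{-\frac12-\frac{3}{2\beta}}\sqrt{\log N},$$ where $c_3=8c_1^2\sqrt{c_2\ell}\,\sqrt{\beta}$.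
   Context: For $x\in X$ and real $a<b$, $E(x;a,b)=\{y\in X: a\le\rho(x,y)\le b\}$. A partition of $X$ consists of finitely many pairwise disjoint (measurable) subsets whose union is $X$. Class $\mathcal{S}_r(t_1,\dots,t_\ell)$: a function $\Phi\in C[0,\pi]$ belongs to it if there exists an $r$-dimensional linear subspace $V_r$ of $C(X)$ such that for every $x\in X$ and each $1\le j\le\ell$ there is $f\in V_r$ with $\Phi(\rho(x,y))=f(y)$ for all $y\in E(x;t_{j-1},t_j)$. *)

theory Defs
  imports "HOL-Probability.Probability"
begin

definition shell :: "'a::metric_space \<Rightarrow> real \<Rightarrow> real \<Rightarrow> 'a set" where
  "shell x a b = {y. a \<le> dist x y \<and> dist x y \<le> b}"

definition measurable_partition :: "'a measure \<Rightarrow> nat \<Rightarrow> (nat \<Rightarrow> 'a set) \<Rightarrow> bool" where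
  "measurable_partition M N P \<longleftrightarrow>
     (\<forall>j\<in>{1..N}. P j \<in> sets M) \<and> disjoint_family_on P {1..N} \<and> (\<Union>j\<in>{1..N}. P j) = space M"

text \<open>An explicit finite basis is required because \<^const>\<open>dim\<close> is 0 on
  infinite-dimensional spaces.\<close>

definition subspace_of_dim :: "nat \<Rightarrow> 'b::real_vector set \<Rightarrow> bool" where
  "subspace_of_dim r V \<longleftrightarrow>
     subspace V \<and> (\<exists>B. finite B \<and> card B = r \<and> independent B \<and> span B = V)"

text \<open>The metric space is the whole type \<^typ>\<open>'a\<close>. The type of bounded continuous
  real functions on it is \<open>C(X)\<close> when \<^typ>\<open>'a\<close> is compact, the only case of interest.
  The breakpoints are \<open>t 0 < \<dots> < t l\<close>, with \<open>t 0 = 0\<close> and \<open>t l = pi\<close>.\<close>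

definition class_S ::
  "'a::metric_space itself \<Rightarrow> nat \<Rightarrow> nat \<Rightarrow> (nat \<Rightarrow> real) \<Rightarrow> (real \<Rightarrow> real) set" where
  "class_S _ r l t = {\<Phi>. continuous_on {0..pi} \<Phi> \<and>
     (\<exists>V :: ('a \<Rightarrow>\<^sub>C real) set. subspace_of_dim r V \<and>
        (\<forall>x::'a. \<forall>j\<in>{1..l}. \<exists>f\<in>V. \<forall>y\<in>shell x (t (j - 1)) (t j).
           \<Phi> (dist x y) = apply_bcontfun f y))}"

end

theory Submission
  imports Defs
begin

text \<open>Split \<open>\<mu>\<close> along the \<open>N\<close> cells \<open>P j\<close> of a partition and replace the part on each cell by a
  sparse measure of the same mass that integrates \<open>V\<close> exactly. For a given \<open>x\<close> this makes an
  error only on the cells not contained in a single shell \<open>E(x; t\<^sub>i\<^sub>-\<^sub>1, t\<^sub>i)\<close>; each of these has its points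
  at distance within \<open>\<delta>\<close> of some \<open>t\<^sub>i\<close>, where \<open>\<delta> = c\<^sub>1 N\<^sup>-\<^sup>1\<^sup>/\<^sup>\<beta>\<close>, so condition (b)
  bounds their number by \<open>N l c\<^sub>2 \<delta>\<close>, and on each the integrand oscillates by at most \<open>\<delta>\<close>.

  Choosing the sparse measures independently at random with the right mean would give the bound by
  Hoeffding's inequality and a union bound over a net of \<open>x\<close>. Here the choice is derandomised:
  the exponential potential \<open>\<Sum> exp(error - variance)\<close> over the net is kept from growing cell by
  cell. Since \<open>exp\<close> lies below its chord, this takes only one more linear constraint
  besides \<open>V\<close> and the total mass, and a system of \<open>r + 2\<close> linear constraints has a nonnegative
  solution with at most \<open>r + 2\<close> atoms. A partition into about \<open>N\<^sup>2\<^sup>\<beta>\<close> cells supplies both the net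
  and a preliminary discretisation of \<open>\<mu>\<close>.\<close>

section \<open>Exponential inequalities\<close>

text \<open>For nonnegative arguments take logarithms: the difference of the two sides has
  derivative \<open>x - sinh x / cosh x\<close>, which is nonnegative because
  \<open>x * cosh x - sinh x\<close> vanishes at 0 and has derivative \<open>x * sinh x\<close>.
  Evenness gives the rest.\<close>

lemma cosh_le_exp_half_square: "cosh (x::real) \<le> exp (x\<^sup>2 / 2)"
proof -
  have main: "cosh y \<le> exp (y\<^sup>2 / 2)" if "y \<ge> 0" for y :: real
  proof -
    define f where "f = (\<lambda>x::real. x\<^sup>2 / 2 - ln (cosh x))"
    have "f 0 \<le> f y"
    proof (rule DERIV_nonneg_imp_nondecreasing[OF that])
      fix x :: real assume x: "0 \<le> x" "x \<le> y"
      have "(f has_real_derivative (x - sinh x / cosh x)) (at x)"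
        unfolding f_def by (auto intro!: derivative_eq_intros simp: field_simps)
      moreover have "sinh x \<le> x * cosh x"
      proof -
        define g where "g = (\<lambda>x::real. x * cosh x - sinh x)"
        have "g 0 \<le> g x"
        proof (rule DERIV_nonneg_imp_nondecreasing[OF x(1)])
          fix u :: real assume u: "0 \<le> u" "u \<le> x"
          have "(g has_real_derivative (u * sinh u)) (at u)"
            unfolding g_def by (auto intro!: derivative_eq_intros)
          then show "\<exists>d. (g has_real_derivative d) (at u) \<and> 0 \<le> d"
            using u by auto
        qed
        then show ?thesis by (simp add: g_def)
      qed
      ultimately show "\<exists>d. (f has_real_derivative d) (at x) \<and> 0 \<le> d"
        by (intro exI[of _ "x - sinh x / cosh x"]) (auto simp: field_simps)
    qed
    then have "ln (cosh y) \<le> y\<^sup>2 / 2" by (simp add: f_def)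
    then show ?thesis by (metis cosh_real_pos exp_le_cancel_iff exp_ln)
  qed
  show ?thesis using main[of x] main[of "-x"] by (cases "x \<ge> 0") auto
qed

text \<open>Convexity puts \<open>exp\<close> on \<open>[-a, a]\<close> below its chord, the line
  with value \<open>cosh a\<close> at 0 and slope \<open>sinh a / a\<close>. This is the pointwise
  core of Hoeffding's lemma: averaging over a mean-zero \<open>z\<close> removes the linear
  term.\<close>

lemma exp_le_chord:
  fixes a z :: real
  assumes "a > 0" "\<bar>z\<bar> \<le> a"
  shows "exp z \<le> exp (a\<^sup>2 / 2) + z * (sinh a / a)"
proof -
  have "exp ((1 - (z + a) / (2 * a)) * (-a) + (z + a) / (2 * a) * a)
      \<le> (1 - (z + a) / (2 * a)) * exp (-a) + (z + a) / (2 * a) * exp a"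
    using convex_onD[OF exp_convex, of "(z + a) / (2 * a)" "-a" a] assms
    by (auto simp: field_simps)
  also have "(1 - (z + a) / (2 * a)) * (-a) + (z + a) / (2 * a) * a = z"
    using assms by (simp add: field_simps)
  also have "(1 - (z + a) / (2 * a)) * exp (-a) + (z + a) / (2 * a) * exp a
      = cosh a + z * (sinh a / a)"
    using assms by (simp add: field_simps cosh_def sinh_def)
  finally show ?thesis using cosh_le_exp_half_square[of a] by linarith
qed

section \<open>Sparse nonnegative solutions of linear systems\<close>

text \<open>Gaussian elimination: an equation with a nonzero coefficient at a pivot \<open>q\<close>
  removes both itself and the unknown \<open>q\<close>, so the surplus of unknowns over equations
  survives.\<close>

lemma homogeneous_system_nontrivial_solution:
  fixes f :: "'i \<Rightarrow> 'p \<Rightarrow> real"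
  assumes "finite I" "finite P" "card I < card P"
  shows "\<exists>h. (\<exists>p\<in>P. h p \<noteq> 0) \<and> (\<forall>i\<in>I. (\<Sum>p\<in>P. h p * f i p) = 0)"
  using assms
proof (induction I arbitrary: P f rule: finite_induct)
  case empty
  then have "P \<noteq> {}" by auto
  then show ?case by (intro exI[of _ "\<lambda>_. 1"]) auto
next
  case (insert i I)
  show ?case
  proof (cases "\<forall>p\<in>P. f i p = 0")
    case True
    have "card I < card P" using insert by simp
    from insert.IH[OF insert.prems(1) this, of f] show ?thesis using True by auto
  next
    case False
    then obtain q where q: "q \<in> P" "f i q \<noteq> 0" by auto
    have "card I < card (P - {q})" using insert q by simp
    with insert.IH[of "P - {q}" "\<lambda>k p. f k p - f i p / f i q * f k q"] insert.prems
    obtain h where h: "\<exists>p\<in>P - {q}. h p \<noteq> 0"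
      "\<forall>k\<in>I. (\<Sum>p\<in>P - {q}. h p * (f k p - f i p / f i q * f k q)) = 0" by auto
    \<comment> \<open>Back substitution: this value at \<open>q\<close> makes equation
      \<open>i\<close> hold; the others then reduce to the eliminated system.\<close>
    define s where "s = - (\<Sum>p\<in>P - {q}. h p * f i p) / f i q"
    have sum: "(\<Sum>p\<in>P. (h(q := s)) p * f k p) = s * f k q + (\<Sum>p\<in>P - {q}. h p * f k p)" for k
      using q insert.prems by (subst sum.remove[of _ q]) auto
    have "(\<Sum>p\<in>P. (h(q := s)) p * f k p) = 0" if "k \<in> insert i I" for k
    proof (cases "k = i")
      case True then show ?thesis unfolding sum unfolding s_def using q by simp
    next
      case False
      with that h(2) have "(\<Sum>p\<in>P - {q}. h p * (f k p - f i p / f i q * f k q)) = 0" by auto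
      then show ?thesis
        unfolding sum unfolding s_def
        by (simp add: algebra_simps sum_subtractf sum_divide_distrib sum_distrib_left)
    qed
    then show ?thesis using h(1) by (intro exI[of _ "h(q := s)"]) auto
  qed
qed

text \<open>Caratheodory's theorem for cones. While the support has more points than there are
  constraints, some nonzero vector on it is annihilated by all of them; moving along it until a
  weight vanishes shrinks the support.\<close>

lemma sparse_nonneg_solution:
  fixes f :: "'i \<Rightarrow> 'p \<Rightarrow> real"
  assumes "finite I" "finite P" "\<And>p. p \<in> P \<Longrightarrow> 0 \<le> w p"
  shows "\<exists>v. (\<forall>p\<in>P. 0 \<le> v p) \<and> card {p\<in>P. v p \<noteq> 0} \<le> card I \<and>
    (\<forall>i\<in>I. (\<Sum>p\<in>P. v p * f i p) = (\<Sum>p\<in>P. w p * f i p))"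
  using assms(3)
proof (induction "card {p\<in>P. w p \<noteq> 0}" arbitrary: w rule: less_induct)
  case less
  let ?S = "{p\<in>P. w p \<noteq> 0}"
  show ?case
  proof (cases "card ?S \<le> card I")
    case True
    then show ?thesis using less.prems by blast
  next
    case False
    obtain h where h: "\<exists>p\<in>?S. h p \<noteq> 0" "\<forall>i\<in>I. (\<Sum>p\<in>?S. h p * f i p) = 0"
      using homogeneous_system_nontrivial_solution[OF assms(1), of ?S f] False assms(2) by auto
    \<comment> \<open>The sign makes some coordinate decrease, so that moving along \<open>g\<close> reaches the boundary.\<close>
    define g where "g = (if \<exists>p\<in>?S. h p < 0 then h else (\<lambda>p. - h p))"
    have g: "\<exists>p\<in>?S. g p < 0" "\<forall>i\<in>I. (\<Sum>p\<in>?S. g p * f i p) = 0"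
      using h unfolding g_def by (force simp: sum_negf)+
    define D where "D = {p\<in>?S. g p < 0}"
    have D: "finite D" "D \<noteq> {}" using g(1) assms(2) by (auto simp: D_def)
    \<comment> \<open>Ratio test: \<open>s\<close> is the largest step along \<open>g\<close> that
      keeps all weights nonnegative. The minimum is attained at \<open>q\<close>, whose weight
      becomes 0.\<close>
    define s where "s = Min ((\<lambda>p. w p / - g p) ` D)"
    have "s \<in> (\<lambda>p. w p / - g p) ` D" unfolding s_def using D by (intro Min_in) auto
    then obtain q where q: "q \<in> D" "s = w q / - g q" by auto
    have s_le: "s \<le> w p / - g p" if "p \<in> D" for p
      unfolding s_def using D that by auto
    have s0: "0 \<le> s" using q less.prems[of q] by (auto simp: D_def divide_nonneg_neg)
    define u where "u = (\<lambda>p. if p \<in> ?S then w p + s * g p else 0)"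
    have u0: "0 \<le> u p" if "p \<in> P" for p
    proof (cases "p \<in> D")
      case True
      then have "s * - g p \<le> w p" using s_le[OF True] by (simp add: D_def field_simps)
      then show ?thesis by (auto simp: u_def)
    next
      case False
      then show ?thesis using s0 less.prems[OF that] by (auto simp: u_def D_def)
    qed
    have "u q = 0" using q by (auto simp: u_def D_def)
    moreover have "q \<in> ?S" using q(1) by (simp add: D_def)
    moreover have "{p\<in>P. u p \<noteq> 0} \<subseteq> ?S" by (auto simp: u_def)
    ultimately have "{p\<in>P. u p \<noteq> 0} \<subset> ?S" by blast
    then have less_card: "card {p\<in>P. u p \<noteq> 0} < card ?S"
      using assms(2) by (intro psubset_card_mono) auto
    have "(\<Sum>p\<in>P. u p * f i p) = (\<Sum>p\<in>P. w p * f i p)" if "i \<in> I" for i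
    proof -
      have "(\<Sum>p\<in>P. u p * f i p) = (\<Sum>p\<in>?S. (w p + s * g p) * f i p)"
        using assms(2) by (intro sum.mono_neutral_cong_right) (auto simp: u_def)
      also have "\<dots> = (\<Sum>p\<in>?S. w p * f i p) + s * (\<Sum>p\<in>?S. g p * f i p)"
        by (simp add: algebra_simps sum.distrib sum_distrib_left)
      also have "\<dots> = (\<Sum>p\<in>?S. w p * f i p)" using g(2) that by simp
      also have "\<dots> = (\<Sum>p\<in>P. w p * f i p)"
        using assms(2) by (intro sum.mono_neutral_left) auto
      finally show ?thesis .
    qed
    then show ?thesis using less.hyps[OF less_card u0] by simp
  qed
qed

section \<open>Sparse weights through an exponential potential\<close>

lemma weighted_average_dist_le:
  fixes w x :: "'p \<Rightarrow> real"
  assumes "\<And>p. p \<in> P \<Longrightarrow> 0 \<le> w p" "sum w P = 1" "\<And>p. p \<in> P \<Longrightarrow> \<bar>x p - c\<bar> \<le> a"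
  shows "\<bar>(\<Sum>p\<in>P. w p * x p) - c\<bar> \<le> a"
proof -
  have "(\<Sum>p\<in>P. w p * x p) - c = (\<Sum>p\<in>P. w p * (x p - c))"
    using assms(2) by (simp add: algebra_simps sum_subtractf flip: sum_distrib_left)
  also have "\<bar>\<dots>\<bar> \<le> (\<Sum>p\<in>P. w p * a)"
    by (rule order_trans[OF sum_abs]) (auto intro!: sum_mono mult_left_mono simp: abs_mult assms)
  also have "\<dots> = a" using assms(2) by (simp flip: sum_distrib_right)
  finally show ?thesis .
qed

text \<open>The derandomised choice on one cell. Here \<open>c k\<close> is the potential of test
  \<open>k\<close> accumulated so far. Tests in \<open>G\<close> see no error by exactness, so only
  the others are discounted by \<open>a\<^sup>2 / 2\<close>. The two atoms beyond
  \<open>card F\<close> pay for the total mass and for the first-order term of the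
  potential.\<close>

lemma sparse_weights_exp_bound:
  fixes g :: "'k \<Rightarrow> 'p \<Rightarrow> real" and F :: "('p \<Rightarrow> real) set"
  assumes fin: "finite P" "finite T" "finite F"
    and w: "\<And>p. p \<in> P \<Longrightarrow> 0 \<le> w p" "sum w P = 1"
    and c: "\<And>k. k \<in> T \<Longrightarrow> 0 \<le> c k" and a: "a > 0"
    and osc: "\<And>k p q. k \<in> T \<Longrightarrow> k \<notin> G \<Longrightarrow> p \<in> P \<Longrightarrow> q \<in> P \<Longrightarrow> \<bar>g k p - g k q\<bar> \<le> a"
    and exact: "\<And>k h. k \<in> T \<Longrightarrow> k \<in> G \<Longrightarrow> (\<And>f. f \<in> F \<Longrightarrow> (\<Sum>p\<in>P. h p * f p) = 0)
      \<Longrightarrow> (\<Sum>p\<in>P. h p * g k p) = 0"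
  obtains v where "\<And>p. p \<in> P \<Longrightarrow> 0 \<le> v p" "sum v P = 1" "card {p\<in>P. v p \<noteq> 0} \<le> card F + 2"
    "(\<Sum>k\<in>T. c k * exp ((\<Sum>p\<in>P. (v p - w p) * g k p) - (if k \<in> G then 0 else a\<^sup>2 / 2))) \<le> sum c T"
proof -
  \<comment> \<open>Preserving \<open>L\<close> makes the first-order terms of all chord bounds cancel, because their slope
    \<open>sinh a / a\<close> does not depend on \<open>k\<close>.\<close>
  define L where "L = (\<lambda>p. \<Sum>k\<in>T - G. c k * g k p)"
  \<comment> \<open>The constant function preserves the total mass; \<open>F\<close> forces zero
    error for tests in \<open>G\<close>.\<close>
  define C where "C = insert (\<lambda>_. 1) (insert L F)"
  have "finite C" using fin by (simp add: C_def)
  from sparse_nonneg_solution[OF this fin(1), of w "\<lambda>f. f"] w(1)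
  obtain v where v_all: "(\<forall>p\<in>P. 0 \<le> v p) \<and> card {p\<in>P. v p \<noteq> 0} \<le> card C \<and>
    (\<forall>f\<in>C. (\<Sum>p\<in>P. v p * f p) = (\<Sum>p\<in>P. w p * f p))" by auto
  then have v: "\<And>p. p \<in> P \<Longrightarrow> 0 \<le> v p" "card {p\<in>P. v p \<noteq> 0} \<le> card C"
    "\<And>f. f \<in> C \<Longrightarrow> (\<Sum>p\<in>P. v p * f p) = (\<Sum>p\<in>P. w p * f p)" by simp_all
  have "card C \<le> card F + 2"
    unfolding C_def using fin(3) by (auto simp: card_insert_if)
  then have card: "card {p\<in>P. v p \<noteq> 0} \<le> card F + 2" using v(2) by linarith
  have sum1: "sum v P = 1" using v(3)[of "\<lambda>_. 1"] w(2) by (simp add: C_def)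
  define z where "z = (\<lambda>k. \<Sum>p\<in>P. (v p - w p) * g k p)"
  have z_eq: "z k = (\<Sum>p\<in>P. v p * g k p) - (\<Sum>p\<in>P. w p * g k p)" for k
    by (simp add: z_def algebra_simps sum_subtractf)
  have z_good: "z k = 0" if "k \<in> T" "k \<in> G" for k
    unfolding z_def using v(3)
    by (intro exact[OF that]) (auto simp: C_def algebra_simps sum_subtractf)
  \<comment> \<open>Averaging twice: each value \<open>g k p\<close> is within \<open>a\<close> of
    the \<open>w\<close>-average, hence so is the \<open>v\<close>-average of these values.\<close>
  have z_bad: "\<bar>z k\<bar> \<le> a" if "k \<in> T" "k \<notin> G" for k
    unfolding z_eq
  proof (rule weighted_average_dist_le[OF v(1) sum1])
    fix p assume "p \<in> P"
    then show "\<bar>g k p - (\<Sum>p\<in>P. w p * g k p)\<bar> \<le> a"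
      using weighted_average_dist_le[OF w, of "g k" "g k p" a] osc[OF that] by (simp add: abs_minus_commute)
  qed
  have "(\<Sum>k\<in>T - G. c k * z k) = (\<Sum>p\<in>P. v p * L p) - (\<Sum>p\<in>P. w p * L p)"
    unfolding z_eq L_def right_diff_distrib sum_subtractf sum_distrib_left
    by (subst (1 3) sum.swap) (simp add: mult_ac)
  also have "\<dots> = 0" using v(3)[of L] by (simp add: C_def)
  finally have cz: "(\<Sum>k\<in>T - G. c k * z k) = 0" .
  have "(\<Sum>k\<in>T. c k * exp (z k - (if k \<in> G then 0 else a\<^sup>2 / 2)))
      \<le> (\<Sum>k\<in>T. c k + (if k \<in> G then 0 else c k * z k * (sinh a / a * exp (- (a\<^sup>2 / 2)))))"
  proof (rule sum_mono)
    fix k assume k: "k \<in> T"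
    show "c k * exp (z k - (if k \<in> G then 0 else a\<^sup>2 / 2))
      \<le> c k + (if k \<in> G then 0 else c k * z k * (sinh a / a * exp (- (a\<^sup>2 / 2))))"
    proof (cases "k \<in> G")
      case True
      then show ?thesis using z_good k by simp
    next
      case False
      have "exp (z k - a\<^sup>2 / 2) = exp (z k) * exp (- (a\<^sup>2 / 2))" by (simp flip: exp_add)
      also have "\<dots> \<le> (exp (a\<^sup>2 / 2) + z k * (sinh a / a)) * exp (- (a\<^sup>2 / 2))"
        using exp_le_chord[OF a z_bad[OF k False]] by (intro mult_right_mono) auto
      also have "\<dots> = 1 + z k * (sinh a / a * exp (- (a\<^sup>2 / 2)))"
        by (simp add: distrib_right flip: exp_add)
      finally have "c k * exp (z k - a\<^sup>2 / 2) \<le> c k * (1 + z k * (sinh a / a * exp (- (a\<^sup>2 / 2))))"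
        by (rule mult_left_mono[OF _ c[OF k]])
      then show ?thesis using False by (simp add: distrib_left mult.assoc)
    qed
  qed
  also have "\<dots> = sum c T + (\<Sum>k\<in>T - G. c k * z k) * (sinh a / a * exp (- (a\<^sup>2 / 2)))"
    unfolding sum.distrib sum_distrib_right
    by (subst sum.mono_neutral_cong_right[of T "T - G"]) (auto simp: fin)
  finally have "(\<Sum>k\<in>T. c k * exp (z k - (if k \<in> G then 0 else a\<^sup>2 / 2))) \<le> sum c T"
    by (simp add: cz)
  then show thesis using that v(1) sum1 card unfolding z_def by blast
qed

text \<open>Cells are treated one after another, the potential left by the earlier cells supplying
  the coefficients \<open>c\<close> for the next. With no cells the potential is
  \<open>card T\<close>, and it never grows.\<close>

lemma sparse_weights_family_exp_bound:
  fixes g :: "'k \<Rightarrow> 'j \<Rightarrow> 'p \<Rightarrow> real" and F :: "'j \<Rightarrow> ('p \<Rightarrow> real) set"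
  assumes fin: "finite J" "finite T" "\<And>j. j \<in> J \<Longrightarrow> finite (P j)" "\<And>j. j \<in> J \<Longrightarrow> finite (F j)"
    and w: "\<And>j p. j \<in> J \<Longrightarrow> p \<in> P j \<Longrightarrow> 0 \<le> w j p" "\<And>j. j \<in> J \<Longrightarrow> sum (w j) (P j) = 1"
    and a: "a > 0"
    and osc: "\<And>j k p q. j \<in> J \<Longrightarrow> k \<in> T \<Longrightarrow> k \<notin> G j \<Longrightarrow> p \<in> P j \<Longrightarrow> q \<in> P j
      \<Longrightarrow> \<bar>g k j p - g k j q\<bar> \<le> a"
    and exact: "\<And>j k h. j \<in> J \<Longrightarrow> k \<in> T \<Longrightarrow> k \<in> G j
      \<Longrightarrow> (\<And>f. f \<in> F j \<Longrightarrow> (\<Sum>p\<in>P j. h p * f p) = 0) \<Longrightarrow> (\<Sum>p\<in>P j. h p * g k j p) = 0"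
  shows "\<exists>v. (\<forall>j\<in>J. (\<forall>p\<in>P j. 0 \<le> v j p) \<and> sum (v j) (P j) = 1 \<and>
      card {p\<in>P j. v j p \<noteq> 0} \<le> card (F j) + 2) \<and>
    (\<Sum>k\<in>T. exp ((\<Sum>j\<in>J. \<Sum>p\<in>P j. (v j p - w j p) * g k j p) - real (card {j\<in>J. k \<notin> G j}) * a\<^sup>2 / 2))
      \<le> real (card T)"
  using fin(1,3,4) w osc exact
proof (induction J rule: finite_induct)
  case empty
  then show ?case by simp
next
  case (insert i J)
  obtain v where v: "\<forall>j\<in>J. (\<forall>p\<in>P j. 0 \<le> v j p) \<and> sum (v j) (P j) = 1 \<and>
      card {p\<in>P j. v j p \<noteq> 0} \<le> card (F j) + 2"
    "(\<Sum>k\<in>T. exp ((\<Sum>j\<in>J. \<Sum>p\<in>P j. (v j p - w j p) * g k j p) - real (card {j\<in>J. k \<notin> G j}) * a\<^sup>2 / 2))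
      \<le> real (card T)"
    using insert.IH[OF insert.prems(1)[OF insertI2] insert.prems(2)[OF insertI2]
      insert.prems(3)[OF insertI2] insert.prems(4)[OF insertI2] insert.prems(5)[OF insertI2]
      insert.prems(6)[OF insertI2]] by blast
  define c where "c = (\<lambda>k. exp ((\<Sum>j\<in>J. \<Sum>p\<in>P j. (v j p - w j p) * g k j p)
    - real (card {j\<in>J. k \<notin> G j}) * a\<^sup>2 / 2))"
  obtain u where u: "\<And>p. p \<in> P i \<Longrightarrow> 0 \<le> u p" "sum u (P i) = 1"
    "card {p\<in>P i. u p \<noteq> 0} \<le> card (F i) + 2"
    "(\<Sum>k\<in>T. c k * exp ((\<Sum>p\<in>P i. (u p - w i p) * g k i p) - (if k \<in> G i then 0 else a\<^sup>2 / 2))) \<le> sum c T"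
    by (rule sparse_weights_exp_bound[of "P i" T "F i" "w i" c a "G i" "\<lambda>k. g k i"])
      (use insert.prems fin(2) a in \<open>auto simp: c_def\<close>)
  let ?v = "v(i := u)"
  \<comment> \<open>Cell \<open>i\<close> multiplies the potential of \<open>k\<close> by one factor
    and enters the count of inexact cells exactly when that factor carries the discount.\<close>
  have "exp ((\<Sum>j\<in>insert i J. \<Sum>p\<in>P j. (?v j p - w j p) * g k j p)
        - real (card {j\<in>insert i J. k \<notin> G j}) * a\<^sup>2 / 2)
      = c k * exp ((\<Sum>p\<in>P i. (u p - w i p) * g k i p) - (if k \<in> G i then 0 else a\<^sup>2 / 2))" for k
  proof -
    have "(\<Sum>j\<in>J. \<Sum>p\<in>P j. (?v j p - w j p) * g k j p) = (\<Sum>j\<in>J. \<Sum>p\<in>P j. (v j p - w j p) * g k j p)"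
      using insert.hyps by (intro sum.cong refl) auto
    moreover have "{j\<in>insert i J. k \<notin> G j} = (if k \<in> G i then {j\<in>J. k \<notin> G j} else insert i {j\<in>J. k \<notin> G j})"
      by auto
    then have "real (card {j\<in>insert i J. k \<notin> G j}) = real (card {j\<in>J. k \<notin> G j}) + (if k \<in> G i then 0 else 1)"
      using insert.hyps by simp
    ultimately show ?thesis
      using insert.hyps by (simp add: c_def field_simps flip: exp_add)
  qed
  then have "(\<Sum>k\<in>T. exp ((\<Sum>j\<in>insert i J. \<Sum>p\<in>P j. (?v j p - w j p) * g k j p)
        - real (card {j\<in>insert i J. k \<notin> G j}) * a\<^sup>2 / 2)) \<le> real (card T)"
    using u(4) v(2) unfolding c_def by simp
  moreover have "\<forall>j\<in>insert i J. (\<forall>p\<in>P j. 0 \<le> ?v j p) \<and> sum (?v j) (P j) = 1 \<and>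
      card {p\<in>P j. ?v j p \<noteq> 0} \<le> card (F j) + 2"
    using u v(1) insert.hyps by auto
  ultimately show ?case by blast
qed

text \<open>A bounded sum of exponentials bounds each of its terms, so taking logarithms controls
  every test at once. This replaces the union bound and costs only the logarithm of the number of
  tests.\<close>

lemma sparse_weights_uniform_error:
  fixes \<phi> :: "'k \<Rightarrow> 'j \<Rightarrow> 'p \<Rightarrow> real" and F :: "'j \<Rightarrow> ('p \<Rightarrow> real) set"
  assumes fin: "finite J" "finite T" "\<And>j. j \<in> J \<Longrightarrow> finite (P j)" "\<And>j. j \<in> J \<Longrightarrow> finite (F j)"
    and "T \<noteq> {}"
    and w: "\<And>j p. j \<in> J \<Longrightarrow> p \<in> P j \<Longrightarrow> 0 \<le> w j p" "\<And>j. j \<in> J \<Longrightarrow> sum (w j) (P j) = 1"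
    and "\<delta> > 0" "b > 0"
    and osc: "\<And>j k p q. j \<in> J \<Longrightarrow> k \<in> T \<Longrightarrow> p \<in> P j \<Longrightarrow> q \<in> P j
      \<Longrightarrow> \<bar>\<phi> k j p - \<phi> k j q\<bar> \<le> \<delta>"
    and exact: "\<And>j k h. j \<in> J \<Longrightarrow> k \<in> T \<Longrightarrow> k \<in> G j
      \<Longrightarrow> (\<And>f. f \<in> F j \<Longrightarrow> (\<Sum>p\<in>P j. h p * f p) = 0) \<Longrightarrow> (\<Sum>p\<in>P j. h p * \<phi> k j p) = 0"
    and bad: "\<And>k. k \<in> T \<Longrightarrow> real (card {j\<in>J. k \<notin> G j}) \<le> b"
  shows "\<exists>v. (\<forall>j\<in>J. (\<forall>p\<in>P j. 0 \<le> v j p) \<and> sum (v j) (P j) = 1 \<and>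
      card {p\<in>P j. v j p \<noteq> 0} \<le> card (F j) + 2) \<and>
    (\<forall>k\<in>T. \<bar>\<Sum>j\<in>J. \<Sum>p\<in>P j. (v j p - w j p) * \<phi> k j p\<bar>
      \<le> \<delta> * sqrt (2 * b * ln (2 * real (card T))))"
proof -
  define E where "E = ln (2 * real (card T))"
  \<comment> \<open>Minimises the bound \<open>(E + b a\<^sup>2 / 2) / \<Lambda>\<close> on the error.\<close>
  define a where "a = sqrt (2 * E / b)"
  \<comment> \<open>Rescales the tests so that their oscillation \<delta> becomes
    \<open>a\<close>.\<close>
  define \<Lambda> where "\<Lambda> = a / \<delta>"
  have card_T: "card T \<ge> 1" using \<open>T \<noteq> {}\<close> fin(2) by (simp add: Suc_leI card_gt_0_iff)
  then have E: "E > 0" unfolding E_def by (intro ln_gt_zero) simp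
  have a: "a > 0" "b * a\<^sup>2 / 2 = E" using E \<open>b > 0\<close> by (auto simp: a_def)
  have \<Lambda>: "\<Lambda> > 0" "\<Lambda> * \<delta> = a" using a \<open>\<delta> > 0\<close> by (auto simp: \<Lambda>_def)
  \<comment> \<open>Every test enters with both signs, so that one-sided bounds give the absolute
    value. This doubles the number of tests, whence the factor 2 in \<open>E\<close>.\<close>
  let ?g = "\<lambda>(k, s) j p. s * \<Lambda> * \<phi> k j p"
  let ?T = "T \<times> {- 1, 1 :: real}"
  let ?G = "\<lambda>j. G j \<times> UNIV"
  have "\<exists>v. (\<forall>j\<in>J. (\<forall>p\<in>P j. 0 \<le> v j p) \<and> sum (v j) (P j) = 1 \<and>
      card {p\<in>P j. v j p \<noteq> 0} \<le> card (F j) + 2) \<and>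
    (\<Sum>k\<in>?T. exp ((\<Sum>j\<in>J. \<Sum>p\<in>P j. (v j p - w j p) * ?g k j p)
      - real (card {j\<in>J. k \<notin> ?G j}) * a\<^sup>2 / 2)) \<le> real (card ?T)"
  proof (rule sparse_weights_family_exp_bound[OF fin(1) _ fin(3,4) w a(1)])
    show "finite ?T" using fin(2) by simp
  next
    fix j k p q assume *: "j \<in> J" "k \<in> ?T" "k \<notin> ?G j" "p \<in> P j" "q \<in> P j"
    obtain k' s where k: "k = (k', s)" by force
    have "\<bar>?g k j p - ?g k j q\<bar> = \<bar>s * \<Lambda> * (\<phi> k' j p - \<phi> k' j q)\<bar>" by (simp add: k algebra_simps)
    also have "\<dots> = \<Lambda> * \<bar>\<phi> k' j p - \<phi> k' j q\<bar>" using * \<Lambda>(1) by (auto simp: k abs_mult)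
    also have "\<dots> \<le> \<Lambda> * \<delta>" using * \<Lambda>(1) osc[of j k' p q] by (intro mult_left_mono) (auto simp: k)
    finally show "\<bar>?g k j p - ?g k j q\<bar> \<le> a" by (simp add: \<Lambda>)
  next
    fix j k h assume *: "j \<in> J" "k \<in> ?T" "k \<in> ?G j" "\<And>f. f \<in> F j \<Longrightarrow> (\<Sum>p\<in>P j. h p * f p) = 0"
    obtain k' s where k: "k = (k', s)" by force
    have "(\<Sum>p\<in>P j. h p * \<phi> k' j p) = 0" using * by (intro exact) (auto simp: k)
    moreover have "(\<Sum>p\<in>P j. h p * ?g k j p) = s * \<Lambda> * (\<Sum>p\<in>P j. h p * \<phi> k' j p)"
      by (simp add: k sum_distrib_left mult_ac)
    ultimately show "(\<Sum>p\<in>P j. h p * ?g k j p) = 0" by simp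
  qed
  then obtain v where v: "\<forall>j\<in>J. (\<forall>p\<in>P j. 0 \<le> v j p) \<and> sum (v j) (P j) = 1 \<and>
      card {p\<in>P j. v j p \<noteq> 0} \<le> card (F j) + 2"
    and v_exp: "(\<Sum>k\<in>?T. exp ((\<Sum>j\<in>J. \<Sum>p\<in>P j. (v j p - w j p) * ?g k j p)
      - real (card {j\<in>J. k \<notin> ?G j}) * a\<^sup>2 / 2)) \<le> real (card ?T)" by (elim exE conjE) rule
  define D where "D = (\<lambda>k. \<Sum>j\<in>J. \<Sum>p\<in>P j. (v j p - w j p) * \<phi> k j p)"
  \<comment> \<open>The term of \<open>(k, s)\<close> is at most \<open>2 * card T = exp E\<close>.
    As the discount is at most \<open>b * a\<^sup>2 / 2 = E\<close>, the scaled error is at most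
    \<open>2 * E\<close>, and \<open>2 * E / a = b * a = sqrt (2 * b * E)\<close>.\<close>
  have D_le: "s * D k \<le> \<delta> * sqrt (2 * b * E)" if k: "k \<in> T" and s: "s \<in> {-1, 1}" for k s
  proof -
    let ?x = "s * \<Lambda> * D k - real (card {j\<in>J. k \<notin> G j}) * a\<^sup>2 / 2"
    have "exp ?x = exp ((\<Sum>j\<in>J. \<Sum>p\<in>P j. (v j p - w j p) * ?g (k, s) j p)
      - real (card {j\<in>J. (k, s) \<notin> ?G j}) * a\<^sup>2 / 2)"
      by (simp add: D_def sum_distrib_left mult_ac)
    also have "\<dots> \<le> real (card ?T)"
      by (rule order_trans[OF member_le_sum v_exp]) (use k s fin(2) in auto)
    also have "\<dots> = exp E" using card_T by (simp add: E_def card_cartesian_product)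
    finally have "?x \<le> E" by simp
    moreover have "real (card {j\<in>J. k \<notin> G j}) * a\<^sup>2 / 2 \<le> b * a\<^sup>2 / 2"
      using bad[OF k] by (intro divide_right_mono mult_right_mono) auto
    ultimately have "s * D k * \<Lambda> \<le> 2 * E" unfolding a(2) by (simp add: mult_ac)
    then have "s * D k \<le> \<delta> * (2 * E / a)"
      using a(1) \<open>\<delta> > 0\<close> by (simp add: \<Lambda>_def field_simps)
    also have "2 * E / a = b * a" using a(1) by (simp add: a(2)[symmetric] power2_eq_square)
    also have "b * a = sqrt (2 * b * E)"
      using a(1) \<open>b > 0\<close> by (simp add: a(2)[symmetric] real_sqrt_mult power2_eq_square)
    finally show ?thesis .
  qed
  have "\<bar>D k\<bar> \<le> \<delta> * sqrt (2 * b * E)" if "k \<in> T" for k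
    using D_le[OF that, of 1] D_le[OF that, of "-1"] by auto
  then show ?thesis using v unfolding D_def E_def by blast
qed

section \<open>Discretisation, enumeration and shells\<close>

lemma integral_partition_error:
  fixes f :: "'a \<Rightarrow> real"
  assumes "prob_space M" "integrable M f" "finite I" "\<And>i. i \<in> I \<Longrightarrow> A i \<in> sets M"
    "disjoint_family_on A I" "(\<Union>i\<in>I. A i) = space M"
    and close: "\<And>i y. i \<in> I \<Longrightarrow> y \<in> A i \<Longrightarrow> \<bar>f y - c i\<bar> \<le> \<eta>"
  shows "\<bar>(LINT y|M. f y) - (\<Sum>i\<in>I. measure M (A i) * c i)\<bar> \<le> \<eta>"
proof -
  interpret prob_space M by fact
  \<comment> \<open>The step function with value \<open>c i\<close> on \<open>A i\<close>: its
    integral is the weighted sum, and it is within \<eta> of \<open>f\<close> everywhere.\<close>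
  define s where "s = (\<lambda>y. \<Sum>i\<in>I. indicator (A i) y * c i)"
  have s_int: "integrable M s"
    unfolding s_def using assms(4) by (intro Bochner_Integration.integrable_sum) (auto intro!: integrable_mult_left simp: less_top[symmetric])
  have s_eq: "(LINT y|M. s y) = (\<Sum>i\<in>I. measure M (A i) * c i)"
    unfolding s_def using assms(4)
    by (subst Bochner_Integration.integral_sum) (auto intro!: integrable_mult_left sum.cong simp: less_top[symmetric])
  have s_val: "s y = c i" if "i \<in> I" "y \<in> A i" for i y
  proof -
    have "indicator (A k) y * c k = (if k = i then c k else 0)" if "k \<in> I" for k
      using assms(5) \<open>i \<in> I\<close> \<open>y \<in> A i\<close> that by (auto simp: disjoint_family_on_def indicator_def)
    then show ?thesis unfolding s_def using that \<open>finite I\<close> by (simp cong: sum.cong)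
  qed
  have "\<bar>(LINT y|M. f y) - (LINT y|M. s y)\<bar> = \<bar>LINT y|M. f y - s y\<bar>"
    using assms(2) s_int by simp
  also have "\<dots> \<le> (LINT y|M. \<bar>f y - s y\<bar>)" by (rule integral_abs_bound)
  also have "\<dots> \<le> (LINT y|M. \<eta>)"
  proof (rule integral_mono)
    fix y assume "y \<in> space M"
    then obtain i where "i \<in> I" "y \<in> A i" using assms(6) by blast
    then show "\<bar>f y - s y\<bar> \<le> \<eta>" using s_val close by auto
  qed (use assms(2) s_int in auto)
  also have "\<dots> = \<eta>" by (simp add: prob_space)
  finally show ?thesis by (simp add: s_eq)
qed

text \<open>Turns at most \<open>M\<close> atoms into a list of exactly \<open>M\<close> by padding
  with weight 0; the points attached to the padding are arbitrary.\<close>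

lemma enumerate_weighted_points:
  fixes v :: "'i \<Rightarrow> real" and z :: "'i \<Rightarrow> 'a"
  assumes "finite A" "card A \<le> M" "\<And>i. i \<in> A \<Longrightarrow> 0 \<le> v i"
  obtains w :: "nat \<Rightarrow> real" and y :: "nat \<Rightarrow> 'a"
  where "\<And>j. 0 \<le> w j" "\<And>\<phi> :: 'a \<Rightarrow> real. (\<Sum>j = 1..M. w j * \<phi> (y j)) = (\<Sum>i\<in>A. v i * \<phi> (z i))"
proof -
  obtain e where e: "bij_betw e {1..card A} A" using ex_bij_betw_nat_finite_1[OF assms(1)] by blast
  define w where "w = (\<lambda>j. if j \<in> {1..card A} then v (e j) else 0)"
  have sums: "(\<Sum>j = 1..M. w j * \<phi> (z (e j))) = (\<Sum>i\<in>A. v i * \<phi> (z i))" for \<phi> :: "'a \<Rightarrow> real"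
  proof -
    have "(\<Sum>j = 1..M. w j * \<phi> (z (e j))) = (\<Sum>j = 1..card A. v (e j) * \<phi> (z (e j)))"
      using assms(2) by (intro sum.mono_neutral_cong_right) (auto simp: w_def)
    also have "\<dots> = (\<Sum>i\<in>A. v i * \<phi> (z i))" by (rule sum.reindex_bij_betw[OF e])
    finally show ?thesis .
  qed
  have "0 \<le> w j" for j
    using assms(3) bij_betw_apply[OF e] by (auto simp: w_def)
  from that[OF this sums] show thesis .
qed

text \<open>Let \<open>i\<close> be the least index with all of \<open>S\<close> within distance
  \<open>t i\<close>. Either \<open>S\<close> also stays beyond \<open>t (i - 1)\<close>, or it has
  points on both sides of that breakpoint and its small diameter keeps it near.\<close>

lemma subset_shell_cases:
  fixes S :: "'a::metric_space set" and t :: "nat \<Rightarrow> real"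
  assumes "l \<ge> 1" and range: "\<And>y. y \<in> S \<Longrightarrow> t 0 \<le> dist x y \<and> dist x y \<le> t l"
    and diam: "\<And>y z. y \<in> S \<Longrightarrow> z \<in> S \<Longrightarrow> dist y z \<le> \<delta>"
  shows "(\<exists>i\<in>{1..l}. S \<subseteq> shell x (t (i - 1)) (t i)) \<or>
    (\<exists>i\<in>{1..<l}. S \<subseteq> shell x (t i - \<delta>) (t i + \<delta>))"
proof -
  define i where "i = (LEAST i. 1 \<le> i \<and> (\<forall>y\<in>S. dist x y \<le> t i))"
  have i: "1 \<le> i" "\<forall>y\<in>S. dist x y \<le> t i" "i \<le> l"
    using LeastI[of "\<lambda>i. 1 \<le> i \<and> (\<forall>y\<in>S. dist x y \<le> t i)" l]
      Least_le[of "\<lambda>i. 1 \<le> i \<and> (\<forall>y\<in>S. dist x y \<le> t i)" l] assms(1) range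
    by (auto simp: i_def)
  show ?thesis
  proof (cases "\<forall>y\<in>S. t (i - 1) \<le> dist x y")
    case True
    then show ?thesis using i by (intro disjI1 bexI[of _ i]) (auto simp: shell_def)
  next
    case False
    then obtain z where z: "z \<in> S" "dist x z < t (i - 1)" by force
    then have "i \<noteq> 1" using range[of z] by auto
    then have "1 \<le> i - 1" "i - 1 < i" using i by auto
    \<comment> \<open>Minimality of \<open>i\<close> applies to \<open>i - 1\<close> because that
      index is still at least 1; together with \<open>z\<close> this shows that \<open>S\<close>
      straddles \<open>t (i - 1)\<close>.\<close>
    then obtain z' where z': "z' \<in> S" "t (i - 1) < dist x z'"
      using not_less_Least[of "i - 1" "\<lambda>i. 1 \<le> i \<and> (\<forall>y\<in>S. dist x y \<le> t i)"]
      unfolding i_def[symmetric] by force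
    have "t (i - 1) - \<delta> \<le> dist x y \<and> dist x y \<le> t (i - 1) + \<delta>" if "y \<in> S" for y
      using diam[OF that z(1)] diam[OF that z'(1)] z(2) z'(2)
        dist_triangle[of x y z] dist_triangle[of x z' y] by (auto simp: dist_commute)
    then show ?thesis using \<open>1 \<le> i - 1\<close> \<open>i \<le> l\<close>
      by (intro disjI2 bexI[of _ "i - 1"]) (auto simp: shell_def)
  qed
qed

lemma dist_le_of_diameter_le:
  fixes S :: "'a::metric_space set"
  assumes "compact (UNIV :: 'a set)" "diameter S \<le> d" "x \<in> S" "y \<in> S"
  shows "dist x y \<le> d"
proof -
  have "bounded S" using compact_imp_bounded[OF assms(1)] by (rule bounded_subset) simp
  then show ?thesis using diameter_bounded_bound[of S x y] assms by simp
qed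

section \<open>Quadrature for Lipschitz kernels\<close>

text \<open>The cells \<open>P j\<close> are those on which measures are made sparse. The finer
  cells \<open>Q k\<close> have two uses: their representatives form the net of test points, and
  their intersections with \<open>P j\<close> carry the atoms of the preliminary
  discretisation.\<close>

lemma sparse_quadrature:
  fixes M :: "'a::metric_space measure" and \<psi> :: "'a \<Rightarrow> 'a \<Rightarrow> real" and B :: "('a \<Rightarrow>\<^sub>C real) set"
  assumes prob: "prob_space M" and int: "\<And>x. integrable M (\<psi> x)" and UNIV: "space M = UNIV"
    and Lip1: "\<And>x x' y. \<bar>\<psi> x y - \<psi> x' y\<bar> \<le> dist x x'"
    and Lip2: "\<And>x y y'. \<bar>\<psi> x y - \<psi> x y'\<bar> \<le> dist y y'"
    and B: "finite B" and "N \<ge> 1" "K \<ge> 1"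
    and P: "measurable_partition M N P" "\<And>j. j \<in> {1..N} \<Longrightarrow> measure M (P j) = 1 / real N"
      "\<And>j y z. j \<in> {1..N} \<Longrightarrow> y \<in> P j \<Longrightarrow> z \<in> P j \<Longrightarrow> dist y z \<le> \<delta>"
    and Q: "measurable_partition M K Q" "\<And>k. k \<in> {1..K} \<Longrightarrow> Q k \<noteq> {}"
      "\<And>k y z. k \<in> {1..K} \<Longrightarrow> y \<in> Q k \<Longrightarrow> z \<in> Q k \<Longrightarrow> dist y z \<le> \<eta>"
    and "\<delta> > 0" "b > 0"
    and bad: "\<And>x. real (card {j\<in>{1..N}. \<not> (\<exists>f\<in>span B. \<forall>y\<in>P j. \<psi> x y = apply_bcontfun f y)}) \<le> b"
  obtains y :: "nat \<Rightarrow> 'a" and u :: "nat \<Rightarrow> real"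
  where "\<And>j. 0 \<le> u j" "(\<Sum>j = 1..(card B + 2) * N. u j) = 1"
    "\<And>x. \<bar>(LINT y|M. \<psi> x y) - (\<Sum>j = 1..(card B + 2) * N. u j * \<psi> x (y j))\<bar>
      \<le> 3 * \<eta> + \<delta> * sqrt (2 * b * ln (2 * real K)) / real N"
proof -
  interpret prob_space M by fact
  have Pm: "\<And>j. j \<in> {1..N} \<Longrightarrow> P j \<in> sets M" "disjoint_family_on P {1..N}" "(\<Union>j\<in>{1..N}. P j) = UNIV"
    and Qm: "\<And>k. k \<in> {1..K} \<Longrightarrow> Q k \<in> sets M" "disjoint_family_on Q {1..K}" "(\<Union>k\<in>{1..K}. Q k) = UNIV"
    using P(1) Q(1) by (auto simp: measurable_partition_def UNIV)
  have "\<forall>k\<in>{1..K}. \<exists>q. q \<in> Q k" using Q(2) by blast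
  then obtain q where q: "\<And>k. k \<in> {1..K} \<Longrightarrow> q k \<in> Q k" by metis
  \<comment> \<open>On cell \<open>P j\<close> the candidate atoms are \<open>z j k\<close>, one for
    each \<open>Q k\<close> that meets it. As \<open>P j\<close> has mass \<open>1 / N\<close>,
    \<open>w j k\<close> is the conditional probability of \<open>Q k\<close> given
    \<open>P j\<close>.\<close>
  define I where "I = (\<lambda>j. {k\<in>{1..K}. P j \<inter> Q k \<noteq> {}})"
  define z where "z = (\<lambda>j k. SOME p. p \<in> P j \<inter> Q k)"
  define w where "w = (\<lambda>j k. real N * measure M (P j \<inter> Q k))"
  have fin_I: "finite (I j)" for j by (simp add: I_def)
  have z: "z j k \<in> P j" "z j k \<in> Q k" if "k \<in> I j" for j k
    using someI_ex[of "\<lambda>p. p \<in> P j \<inter> Q k"] that by (auto simp: I_def z_def)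
  have w_nonneg: "0 \<le> w j k" for j k by (simp add: w_def)
  have w_sum: "sum (w j) (I j) = 1" if j: "j \<in> {1..N}" for j
  proof -
    have "P j = (\<Union>k\<in>{1..K}. P j \<inter> Q k)" using Qm(3) by blast
    then have "1 / real N = measure M (\<Union>k\<in>{1..K}. P j \<inter> Q k)" using P(2)[OF j] by simp
    also have "\<dots> = (\<Sum>k\<in>{1..K}. measure M (P j \<inter> Q k))"
      using Pm(1)[OF j] Qm(1,2)
      by (intro finite_measure_finite_Union) (auto simp: disjoint_family_on_def)
    also have "\<dots> = (\<Sum>k\<in>I j. measure M (P j \<inter> Q k))"
      by (intro sum.mono_neutral_right) (auto simp: I_def)
    finally have "(\<Sum>k\<in>I j. measure M (P j \<inter> Q k)) = 1 / real N" ..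
    then show ?thesis using \<open>N \<ge> 1\<close> by (simp add: w_def flip: sum_distrib_left)
  qed
  \<comment> \<open>\<open>F j\<close> samples the basis at the atoms of cell \<open>j\<close>;
    \<open>G j\<close> collects the net points whose kernel agrees on \<open>P j\<close> with an
    element of \<open>span B\<close>.\<close>
  define F where "F = (\<lambda>j. (\<lambda>f k. apply_bcontfun f (z j k)) ` B)"
  define G where "G = (\<lambda>j. {k. \<exists>f\<in>span B. \<forall>y\<in>P j. \<psi> (q k) y = apply_bcontfun f y})"
  have "\<exists>v. (\<forall>j\<in>{1..N}. (\<forall>k\<in>I j. 0 \<le> v j k) \<and> sum (v j) (I j) = 1 \<and>
      card {k\<in>I j. v j k \<noteq> 0} \<le> card (F j) + 2) \<and>
    (\<forall>m\<in>{1..K}. \<bar>\<Sum>j\<in>{1..N}. \<Sum>k\<in>I j. (v j k - w j k) * \<psi> (q m) (z j k)\<bar>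
      \<le> \<delta> * sqrt (2 * b * ln (2 * real (card {1..K}))))"
  proof (rule sparse_weights_uniform_error[of "{1..N}" "{1..K}" I F w \<delta> b "\<lambda>m j k. \<psi> (q m) (z j k)" G])
    fix j m k k' assume "j \<in> {1..N}" "m \<in> {1..K}" "k \<in> I j" "k' \<in> I j"
    then show "\<bar>\<psi> (q m) (z j k) - \<psi> (q m) (z j k')\<bar> \<le> \<delta>"
      using Lip2[of "q m" "z j k" "z j k'"] P(3)[of j "z j k" "z j k'"] z by fastforce
  next
    fix j m h assume *: "j \<in> {1..N}" "m \<in> {1..K}" "m \<in> G j"
      "\<And>f. f \<in> F j \<Longrightarrow> (\<Sum>k\<in>I j. h k * f k) = 0"
    then obtain f where f: "f \<in> span B" "\<And>y. y \<in> P j \<Longrightarrow> \<psi> (q m) y = apply_bcontfun f y"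
      by (auto simp: G_def)
    \<comment> \<open>The condition is linear in \<open>f\<close>, so it passes from
      \<open>B\<close> to its span.\<close>
    from f(1) have "(\<Sum>k\<in>I j. h k * apply_bcontfun f (z j k)) = 0"
    proof (rule span_induct)
      show "subspace {f. (\<Sum>k\<in>I j. h k * apply_bcontfun f (z j k)) = 0}"
        by (auto simp: subspace_def plus_bcontfun.rep_eq scaleR_bcontfun.rep_eq zero_bcontfun.rep_eq
            distrib_left sum.distrib mult.left_commute simp flip: sum_distrib_left)
    qed (use *(4) in \<open>auto simp: F_def\<close>)
    then show "(\<Sum>k\<in>I j. h k * \<psi> (q m) (z j k)) = 0" using f(2) z by (simp cong: sum.cong)
  next
    fix m assume "m \<in> {1..K}"
    show "real (card {j\<in>{1..N}. m \<notin> G j}) \<le> b" using bad[of "q m"] by (simp add: G_def)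
  qed (use \<open>K \<ge> 1\<close> \<open>\<delta> > 0\<close> \<open>b > 0\<close> w_nonneg w_sum fin_I B in \<open>auto simp: F_def\<close>)
  then obtain v where v_all: "(\<forall>j\<in>{1..N}. (\<forall>k\<in>I j. 0 \<le> v j k) \<and> sum (v j) (I j) = 1 \<and>
      card {k\<in>I j. v j k \<noteq> 0} \<le> card (F j) + 2) \<and>
    (\<forall>m\<in>{1..K}. \<bar>\<Sum>j\<in>{1..N}. \<Sum>k\<in>I j. (v j k - w j k) * \<psi> (q m) (z j k)\<bar>
      \<le> \<delta> * sqrt (2 * b * ln (2 * real (card {1..K}))))" ..
  then have v: "\<And>j k. j \<in> {1..N} \<Longrightarrow> k \<in> I j \<Longrightarrow> 0 \<le> v j k"
    "\<And>j. j \<in> {1..N} \<Longrightarrow> sum (v j) (I j) = 1"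
    "\<And>j. j \<in> {1..N} \<Longrightarrow> card {k\<in>I j. v j k \<noteq> 0} \<le> card (F j) + 2"
    and v_err: "\<And>m. m \<in> {1..K} \<Longrightarrow> \<bar>\<Sum>j\<in>{1..N}. \<Sum>k\<in>I j. (v j k - w j k) * \<psi> (q m) (z j k)\<bar>
      \<le> \<delta> * sqrt (2 * b * ln (2 * real K))" by simp_all
  \<comment> \<open>Only atoms of nonzero weight count: at most \<open>card B + 2\<close> in each of
    the \<open>N\<close> cells.\<close>
  define A where "A = Sigma {1..N} (\<lambda>j. {k\<in>I j. v j k \<noteq> 0})"
  have fin_A: "finite A" using fin_I by (auto simp: A_def)
  have "card A = (\<Sum>j\<in>{1..N}. card {k\<in>I j. v j k \<noteq> 0})"
    unfolding A_def using fin_I by (intro card_SigmaI) auto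
  also have "\<dots> \<le> (\<Sum>j\<in>{1..N}. card B + 2)"
  proof (rule sum_mono)
    fix j assume "j \<in> {1..N}"
    then show "card {k\<in>I j. v j k \<noteq> 0} \<le> card B + 2"
      using v(3)[of j] card_image_le[OF B, of "\<lambda>f k. apply_bcontfun f (z j k)"] by (simp add: F_def)
  qed
  finally have card_A: "card A \<le> (card B + 2) * N" by (simp add: mult.commute)
  \<comment> \<open>Division by \<open>N\<close> gives each cell its mass \<open>1 / N\<close>
    back.\<close>
  define V where "V = (\<lambda>(j, k). v j k / real N)"
  define Z where "Z = (\<lambda>(j, k). z j k)"
  have V_nonneg: "0 \<le> V i" if "i \<in> A" for i
    using that v(1) by (auto simp: A_def V_def)
  obtain u :: "nat \<Rightarrow> real" and y :: "nat \<Rightarrow> 'a" where u: "\<And>j. 0 \<le> u j" and u_sum_A: "\<And>\<phi> :: 'a \<Rightarrow> real.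
      (\<Sum>j = 1..(card B + 2) * N. u j * \<phi> (y j)) = (\<Sum>i\<in>A. V i * \<phi> (Z i))"
    using V_nonneg by (rule enumerate_weighted_points[where v = V and z = Z, OF fin_A card_A]) (assumption, rule that)
  have u_sum: "(\<Sum>j = 1..(card B + 2) * N. u j * \<phi> (y j)) = (\<Sum>j\<in>{1..N}. \<Sum>k\<in>I j. v j k / real N * \<phi> (z j k))"
    for \<phi> :: "'a \<Rightarrow> real"
  proof -
    have "(\<Sum>i\<in>A. V i * \<phi> (Z i))
      = (\<Sum>j\<in>{1..N}. \<Sum>k\<in>{k\<in>I j. v j k \<noteq> 0}. v j k / real N * \<phi> (z j k))"
      unfolding A_def using fin_I by (subst sum.Sigma) (auto intro!: sum.cong simp: V_def Z_def)
    also have "\<dots> = (\<Sum>j\<in>{1..N}. \<Sum>k\<in>I j. v j k / real N * \<phi> (z j k))"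
      using fin_I by (intro sum.cong sum.mono_neutral_left) auto
    finally show ?thesis by (simp only: u_sum_A)
  qed
  have u_one: "(\<Sum>j = 1..(card B + 2) * N. u j) = 1"
    using u_sum[of "\<lambda>_. 1"] v(2) \<open>N \<ge> 1\<close> by (simp flip: sum_divide_distrib)
  define R where "R = (\<lambda>x. \<Sum>j = 1..(card B + 2) * N. u j * \<psi> x (y j))"
  have R_Lip: "\<bar>R x - R x'\<bar> \<le> dist x x'" for x x'
    using weighted_average_dist_le[of "{1..(card B + 2) * N}" u "\<lambda>j. \<psi> x (y j) - \<psi> x' (y j)" 0 "dist x x'"]
      u u_one Lip1[of x _ x'] by (simp add: R_def right_diff_distrib sum_subtractf)
  have int_Lip: "\<bar>(LINT y|M. \<psi> x y) - (LINT y|M. \<psi> x' y)\<bar> \<le> dist x x'" for x x'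
  proof -
    have "\<bar>(LINT y|M. \<psi> x y) - (LINT y|M. \<psi> x' y)\<bar> = \<bar>LINT y|M. \<psi> x y - \<psi> x' y\<bar>" using int by simp
    also have "\<dots> \<le> (LINT y|M. \<bar>\<psi> x y - \<psi> x' y\<bar>)" by (rule integral_abs_bound)
    also have "\<dots> \<le> (LINT y|M. dist x x')" using int Lip1 by (intro integral_mono) auto
    finally show ?thesis by (simp add: prob_space)
  qed
  have discr: "\<bar>(LINT y|M. \<psi> x y) - (\<Sum>j\<in>{1..N}. \<Sum>k\<in>I j. w j k / real N * \<psi> x (z j k))\<bar> \<le> \<eta>" for x
  proof -
    \<comment> \<open>Uses the common refinement of both partitions. For an empty intersection
      \<open>z\<close> is arbitrary, but the closeness condition is vacuous and the mass is
      0.\<close>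
    have "\<bar>(LINT y|M. \<psi> x y) - (\<Sum>i\<in>{1..N} \<times> {1..K}. measure M (P (fst i) \<inter> Q (snd i)) * \<psi> x (z (fst i) (snd i)))\<bar> \<le> \<eta>"
    proof (rule integral_partition_error[OF prob int])
      fix i y assume "i \<in> {1..N} \<times> {1..K}" "y \<in> P (fst i) \<inter> Q (snd i)"
      then show "\<bar>\<psi> x y - \<psi> x (z (fst i) (snd i))\<bar> \<le> \<eta>"
        using Lip2[of x y "z (fst i) (snd i)"] Q(3)[of "snd i" y "z (fst i) (snd i)"]
          z[of "snd i" "fst i"] by (fastforce simp: I_def)
    next
      show "disjoint_family_on (\<lambda>i. P (fst i) \<inter> Q (snd i)) ({1..N} \<times> {1..K})"
        unfolding disjoint_family_on_def
      proof (intro ballI impI)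
        fix i i' assume i: "i \<in> {1..N} \<times> {1..K}" "i' \<in> {1..N} \<times> {1..K}" "i \<noteq> i'"
        then consider "fst i \<noteq> fst i'" | "snd i \<noteq> snd i'" by (auto simp: prod_eq_iff)
        then have "P (fst i) \<inter> P (fst i') = {} \<or> Q (snd i) \<inter> Q (snd i') = {}"
          using i disjoint_family_onD[OF Pm(2), of "fst i" "fst i'"]
            disjoint_family_onD[OF Qm(2), of "snd i" "snd i'"] by (cases; simp add: mem_Times_iff)
        then show "P (fst i) \<inter> Q (snd i) \<inter> (P (fst i') \<inter> Q (snd i')) = {}" by blast
      qed
      have "y \<in> (\<Union>i\<in>{1..N} \<times> {1..K}. P (fst i) \<inter> Q (snd i))" for y
      proof -
        obtain j k where "j \<in> {1..N}" "y \<in> P j" "k \<in> {1..K}" "y \<in> Q k" using Pm(3) Qm(3) by blast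
        then show ?thesis by (intro UN_I[of "(j, k)"]) auto
      qed
      then show "(\<Union>i\<in>{1..N} \<times> {1..K}. P (fst i) \<inter> Q (snd i)) = space M" unfolding UNIV by blast
    qed (use Pm(1) Qm(1) in auto)
    moreover have "(\<Sum>i\<in>{1..N} \<times> {1..K}. measure M (P (fst i) \<inter> Q (snd i)) * \<psi> x (z (fst i) (snd i)))
      = (\<Sum>j\<in>{1..N}. \<Sum>k\<in>{1..K}. measure M (P j \<inter> Q k) * \<psi> x (z j k))"
      by (simp add: sum.cartesian_product case_prod_beta)
    moreover have "\<dots> = (\<Sum>j\<in>{1..N}. \<Sum>k\<in>I j. w j k / real N * \<psi> x (z j k))"
      using \<open>N \<ge> 1\<close> by (intro sum.cong sum.mono_neutral_cong_right) (auto simp: I_def w_def)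
    ultimately show ?thesis by simp
  qed
  \<comment> \<open>Compare with the net point \<open>q m\<close> of the cell containing
    \<open>x\<close>. Moving the integral, moving the quadrature sum and discretising the measure
    cost \<eta> each; the last term is the sparsification error at \<open>q m\<close>.\<close>
  have "\<bar>(LINT y|M. \<psi> x y) - R x\<bar> \<le> 3 * \<eta> + \<delta> * sqrt (2 * b * ln (2 * real K)) / real N" for x
  proof -
    obtain m where m: "m \<in> {1..K}" "x \<in> Q m" using Qm(3) by blast
    have "R (q m) - (\<Sum>j\<in>{1..N}. \<Sum>k\<in>I j. w j k / real N * \<psi> (q m) (z j k))
      = (\<Sum>j\<in>{1..N}. \<Sum>k\<in>I j. (v j k - w j k) * \<psi> (q m) (z j k)) / real N"
      unfolding R_def u_sum by (simp add: algebra_simps diff_divide_distrib sum_subtractf sum_divide_distrib)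
    then have "\<bar>R (q m) - (\<Sum>j\<in>{1..N}. \<Sum>k\<in>I j. w j k / real N * \<psi> (q m) (z j k))\<bar>
      \<le> \<delta> * sqrt (2 * b * ln (2 * real K)) / real N"
      using v_err[OF m(1)] by (simp add: divide_right_mono)
    then show ?thesis
      using discr[of "q m"] int_Lip[of x "q m"] R_Lip[of x "q m"] Q(3)[OF m q[OF m(1)]] by linarith
  qed
  from that[OF u u_one this[unfolded R_def]] show thesis .
qed

section \<open>The convergence rate\<close>

text \<open>With \<open>K\<close> of order \<open>N powr (2 * \<beta>)\<close> the net has mesh at
  most \<open>c1 / N\<^sup>2\<close>, below the target rate, while \<open>ln (2 * K)\<close> is
  still at most \<open>3 * \<beta> * ln N\<close>. The main term then contributes a constant 3 and
  the mesh terms another 3, within the allowed 8.\<close>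

lemma rate_estimate:
  fixes \<beta> c1 c2 :: real and N l :: nat
  assumes "\<beta> \<ge> 1" "c1 > 1" "c2 > 1" "l \<ge> 1" "N \<ge> 4"
  defines "K \<equiv> nat \<lceil>real N powr (2 * \<beta>)\<rceil>" and "\<delta> \<equiv> c1 * real N powr (- 1 / \<beta>)"
  shows "3 * (c1 * real K powr (- 1 / \<beta>)) + \<delta> * sqrt (2 * (real N * real l * c2 * \<delta>) * ln (2 * real K)) / real N
    \<le> (8 * c1\<^sup>2 * sqrt (c2 * real l) * sqrt \<beta>)
       * real N powr (- 1 / 2 - 3 / (2 * \<beta>)) * sqrt (ln (real N))"
proof -
  define R where "R = real N powr (- 1 / 2 - 3 / (2 * \<beta>))"
  define E where "E = ln (2 * real K)"
  define S where "S = sqrt (c2 * real l) * sqrt \<beta> * sqrt (ln (real N))"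
  have N: "real N \<ge> 4" using assms(5) by simp
  have R: "R > 0" using N by (simp add: R_def)
  have N2: "1 \<le> real N powr (2 * \<beta>)" using N assms(1) by (intro ge_one_powr_ge_zero) auto
  have K: "real N powr (2 * \<beta>) \<le> real K" "real K \<le> 2 * real N powr (2 * \<beta>)"
    using N2 unfolding K_def by linarith+
  have ln4: "1 \<le> ln (4::real)" using exp_le by (subst ln_ge_iff) auto
  have lnN: "ln 4 \<le> ln (real N)" using N by simp
  have "real K powr (- 1 / \<beta>) \<le> (real N powr (2 * \<beta>)) powr (- 1 / \<beta>)"
    using K(1) N2 N assms(1) by (intro powr_mono2') auto
  also have "\<dots> = real N powr (- 2)" using assms(1) by (simp add: powr_powr)
  \<comment> \<open>From \<beta> \<ge> 1, the exponent 1/2 + 3/(2\<beta>) is at most 2.\<close>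
  also have "\<dots> \<le> R"
    unfolding R_def using N assms(1) by (intro powr_mono) (auto simp: field_simps)
  finally have KR: "real K powr (- 1 / \<beta>) \<le> R" .
  have "E \<le> ln (4 * real N powr (2 * \<beta>))"
    unfolding E_def using K N2 by (intro ln_mono) auto
  also have "\<dots> = ln 4 + 2 * \<beta> * ln (real N)" using N by (simp add: ln_mult ln_powr)
  \<comment> \<open>Here N \<ge> 4 absorbs the constant of the logarithm.\<close>
  also have "ln 4 \<le> \<beta> * ln (real N)"
    using mult_right_mono[OF assms(1), of "ln (real N)"] lnN ln4 by linarith
  finally have E: "E \<le> 3 * \<beta> * ln (real N)" by simp
  have E0: "0 \<le> E" unfolding E_def using K N2 by (intro ln_ge_zero) linarith
  have \<delta>: "\<delta> > 0" unfolding \<delta>_def using N assms(2) by simp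
  \<comment> \<open>The rate is tuned to this identity: the squared main term is
    \<open>\<delta> ^ 3 / N\<close> times factors independent of the powers of \<open>N\<close>,
    apart from the logarithm.\<close>
  have "R\<^sup>2 = real N powr (- 1 - 3 / \<beta>)"
    using N by (simp add: R_def power2_eq_square flip: powr_add)
  also have "\<dots> = real N powr (- 3 / \<beta> - 1)"
    by (intro arg_cong[where f = "\<lambda>e. real N powr e"]) simp
  also have "\<dots> = real N powr (- 3 / \<beta>) / real N" using N by (subst powr_diff) auto
  also have "real N powr (- 3 / \<beta>) = (real N powr (- 1 / \<beta>)) ^ 3"
    using N by (simp add: power3_eq_cube flip: powr_add)
  finally have R2: "c1 ^ 3 * R\<^sup>2 = \<delta> ^ 3 / real N"
    by (simp add: \<delta>_def power_mult_distrib)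
  have "\<delta> * sqrt (2 * (real N * real l * c2 * \<delta>) * E) / real N
      = sqrt ((\<delta> / real N)\<^sup>2 * (2 * (real N * real l * c2 * \<delta>) * E))"
    using \<delta> by (simp only: real_sqrt_mult real_sqrt_abs) simp
  also have "(\<delta> / real N)\<^sup>2 * (2 * (real N * real l * c2 * \<delta>) * E) = 2 * E * real l * c2 * (\<delta> ^ 3 / real N)"
    using N by (simp add: field_simps power2_eq_square power3_eq_cube)
  \<comment> \<open>Rounding 6 up to 9 and \<open>c1 ^ 3\<close> up to \<open>c1 ^ 4\<close> lets
    the root be taken exactly.\<close>
  also have "sqrt \<dots> \<le> sqrt (9 * (\<beta> * ln (real N)) * real l * c2 * (c1 ^ 4 * R\<^sup>2))"
  proof -
    have "2 * E \<le> 9 * (\<beta> * ln (real N))" using E E0 by (simp add: mult_ac)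
    moreover have "c1 ^ 3 * R\<^sup>2 \<le> c1 ^ 4 * R\<^sup>2"
      using assms(2) by (intro mult_right_mono power_increasing) auto
    moreover have "p * real l * c2 * q \<le> p' * real l * c2 * q'"
      if "p \<le> p'" "q \<le> q'" "0 \<le> p'" "0 \<le> q" for p p' q q' :: real
      using that assms(3) by (intro mult_mono mult_nonneg_nonneg) auto
    ultimately show ?thesis
      unfolding R2[symmetric] using assms(1,2) lnN ln4 by simp
  qed
  also have "\<dots> = 3 * c1\<^sup>2 * S * R"
    using R assms(1-4) lnN ln4
    by (intro real_sqrt_unique) (auto simp: S_def power_mult_distrib mult_ac)
  finally have main: "\<delta> * sqrt (2 * (real N * real l * c2 * \<delta>) * E) / real N \<le> 3 * c1\<^sup>2 * S * R" .
  \<comment> \<open>All factors of \<open>S\<close> are at least 1, so the mesh term can be absorbed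
    into a multiple of \<open>c1\<^sup>2 * S * R\<close>.\<close>
  have "1 * 1 \<le> c2 * real l" using assms(3,4) by (intro mult_mono) auto
  then have "1 * 1 * 1 \<le> S" unfolding S_def using assms(1) ln4 lnN
    by (intro mult_mono) auto
  moreover have "c1 * 1 \<le> c1 * c1" using assms(2) by (intro mult_left_mono) auto
  ultimately have "c1 * 1 \<le> c1\<^sup>2 * S" unfolding power2_eq_square
    using assms(2) by (intro mult_mono) auto
  then have "3 * (c1 * real K powr (- 1 / \<beta>)) \<le> 3 * (c1\<^sup>2 * S * R)"
    using KR R assms(2) by (intro mult_left_mono mult_mono) auto
  moreover have "0 \<le> c1\<^sup>2 * S * R" using R \<open>1 * 1 * 1 \<le> S\<close> by simp
  ultimately have "3 * (c1 * real K powr (- 1 / \<beta>)) + \<delta> * sqrt (2 * (real N * real l * c2 * \<delta>) * E) / real N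
    \<le> 8 * (c1\<^sup>2 * S * R)" using main by linarith
  then show ?thesis by (simp add: E_def S_def R_def mult_ac)
qed

section \<open>Application to distance kernels\<close>

theorem theorem5p2:
  fixes \<mu> :: "'a::metric_space measure"
    and r l :: nat and t :: "nat \<Rightarrow> real" and \<Phi> :: "real \<Rightarrow> real"
    and \<beta> c1 c2 :: real
  assumes compact_X: "compact (UNIV :: 'a set)"
    and diam_X: "diameter (UNIV :: 'a set) = pi"
    and t_ends: "t 0 = 0" "t l = pi"
    and t_mono: "strict_mono_on {0..l} t"
    and Phi_cont: "continuous_on {0..pi} \<Phi>"
    and Phi_Lip: "\<And>s s'. s \<in> {0..pi} \<Longrightarrow> s' \<in> {0..pi} \<Longrightarrow> \<bar>\<Phi> s - \<Phi> s'\<bar> \<le> \<bar>s - s'\<bar>"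
    and Phi_S: "\<Phi> \<in> class_S TYPE('a) r l t"
    and beta: "\<beta> \<ge> 1" and c1: "c1 > 1" and c2: "c2 > 1"
    and mu_prob: "prob_space \<mu>" and mu_borel: "sets \<mu> = sets borel"
    and cond_a: "\<And>N::nat. N \<ge> 1 \<Longrightarrow> \<exists>P. measurable_partition \<mu> N P \<and>
        (\<forall>j\<in>{1..N}. measure \<mu> (P j) = 1 / real N \<and>
            diameter (P j) \<le> c1 * real N powr (- 1 / \<beta>))"
    and cond_b: "\<And>x \<delta> j. 0 < \<delta> \<Longrightarrow> \<delta> < pi \<Longrightarrow> 1 \<le> j \<Longrightarrow> j < l \<Longrightarrow>
        measure \<mu> (shell x (t j - \<delta>) (t j + \<delta>)) \<le> c2 * \<delta>"
  shows "\<forall>N\<ge>4::nat. \<exists>(y :: nat \<Rightarrow> 'a) (w :: nat \<Rightarrow> real).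
      (\<forall>j\<in>{1..(r + 2) * N}. w j \<ge> 0) \<and> (\<Sum>j = 1..(r + 2) * N. w j) = 1 \<and>
      (\<forall>x. \<bar>(LINT y'|\<mu>. \<Phi> (dist x y')) - (\<Sum>j = 1..(r + 2) * N. w j * \<Phi> (dist x (y j)))\<bar>
         \<le> (8 * c1\<^sup>2 * sqrt (c2 * real l) * sqrt \<beta>)
            * real N powr (- 1 / 2 - 3 / (2 * \<beta>)) * sqrt (ln (real N)))"
proof (intro allI impI)
  fix N :: nat assume N: "4 \<le> N"
  interpret prob_space \<mu> by (rule mu_prob)
  have space: "space \<mu> = UNIV" using sets_eq_imp_space_eq[OF mu_borel] by simp
  have l: "l \<ge> 1" using t_ends pi_gt_zero by (cases l) auto
  have dist_pi: "dist x y \<in> {0..pi}" for x y :: 'a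
    using dist_le_of_diameter_le[OF compact_X, of UNIV pi x y] diam_X by simp
  define \<psi> where "\<psi> = (\<lambda>x y :: 'a. \<Phi> (dist x y))"
  have Lip: "\<bar>\<Phi> (dist x y) - \<Phi> (dist x' y')\<bar> \<le> \<bar>dist x y - dist x' y'\<bar>" for x y x' y' :: 'a
    by (rule Phi_Lip[OF dist_pi dist_pi])
  have Lip2: "\<bar>\<psi> x y - \<psi> x y'\<bar> \<le> dist y y'" for x y y'
    using Lip[of x y x y'] abs_dist_diff_le[of y x y'] by (simp add: \<psi>_def dist_commute)
  have Lip1: "\<bar>\<psi> x y - \<psi> x' y\<bar> \<le> dist x x'" for x x' y
    using Lip2[of y x x'] by (simp add: \<psi>_def dist_commute)
  have int: "integrable \<mu> (\<psi> x)" for x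
  proof (rule integrable_const_bound[where B = "\<bar>\<Phi> 0\<bar> + pi"])
    have "\<bar>\<psi> x y\<bar> \<le> \<bar>\<Phi> 0\<bar> + pi" for y
      using Lip2[of x y x] dist_pi[of y x] by (simp add: \<psi>_def)
    then show "AE y in \<mu>. norm (\<psi> x y) \<le> \<bar>\<Phi> 0\<bar> + pi" by simp
    have "continuous_on UNIV (\<psi> x)"
      unfolding \<psi>_def using dist_pi by (intro continuous_on_compose2[OF Phi_cont] continuous_intros) auto
    then show "\<psi> x \<in> borel_measurable \<mu>"
      unfolding measurable_cong_sets[OF mu_borel refl] by (rule borel_measurable_continuous_onI)
  qed
  obtain B :: "('a \<Rightarrow>\<^sub>C real) set" where B: "finite B" "card B = r"
    and exact: "\<And>x j. j \<in> {1..l} \<Longrightarrow>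
      \<exists>f\<in>span B. \<forall>y\<in>shell x (t (j - 1)) (t j). \<Phi> (dist x y) = apply_bcontfun f y"
    using Phi_S unfolding class_S_def subspace_of_dim_def by blast
  define K where "K = nat \<lceil>real N powr (2 * \<beta>)\<rceil>"
  define \<delta> where "\<delta> = c1 * real N powr (- 1 / \<beta>)"
  define \<eta> where "\<eta> = c1 * real K powr (- 1 / \<beta>)"
  \<comment> \<open>\<open>N\<close> times the bound \<open>l * c2 * \<delta>\<close> on the measure
    of the shells around the breakpoints.\<close>
  define b where "b = real N * real l * c2 * \<delta>"
  have "0 < real N powr (2 * \<beta>)" using N by simp
  then have K: "K \<ge> 1" unfolding K_def by linarith
  have \<delta>: "\<delta> > 0" using N c1 by (simp add: \<delta>_def)
  have b: "b > 0" using N l c2 \<delta> by (simp add: b_def)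
  obtain P where P: "measurable_partition \<mu> N P" "\<And>j. j \<in> {1..N} \<Longrightarrow> measure \<mu> (P j) = 1 / real N"
    "\<And>j. j \<in> {1..N} \<Longrightarrow> diameter (P j) \<le> \<delta>"
    using cond_a[of N] N unfolding \<delta>_def by auto
  obtain Q where Q: "measurable_partition \<mu> K Q" "\<And>k. k \<in> {1..K} \<Longrightarrow> measure \<mu> (Q k) = 1 / real K"
    "\<And>k. k \<in> {1..K} \<Longrightarrow> diameter (Q k) \<le> \<eta>"
    using cond_a[OF K] unfolding \<eta>_def by auto
  \<comment> \<open>Cells of mass \<open>1 / K > 0\<close> cannot be empty.\<close>
  have Q_ne: "Q k \<noteq> {}" if "k \<in> {1..K}" for k
    using Q(2)[OF that] K by auto
  note P_dist = dist_le_of_diameter_le[OF compact_X P(3)]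
  note Q_dist = dist_le_of_diameter_le[OF compact_X Q(3)]
  have shell_sets: "shell x a a' \<in> sets \<mu>" for x a a'
  proof -
    have "closed (shell x a a')" unfolding shell_def
      by (intro closed_Collect_conj closed_Collect_le continuous_intros)
    then show ?thesis by (simp add: mu_borel)
  qed
  have shell_measure: "measure \<mu> (shell x (t i - \<delta>) (t i + \<delta>)) \<le> c2 * \<delta>" if "i \<in> {1..<l}" for x i
  proof (cases "\<delta> < pi")
    case True
    then show ?thesis using cond_b[OF \<delta>, of i x] that by simp
  next
    \<comment> \<open>Condition (b) does not cover such \<delta>, but then
      \<open>c2 * \<delta>\<close> exceeds 1, the total mass.\<close>
    case False
    have "1 * 1 \<le> c2 * \<delta>" using False c2 pi_gt3 by (intro mult_mono) auto
    then show ?thesis using prob_le_1[of "shell x (t i - \<delta>) (t i + \<delta>)"] by linarith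
  qed
  have bad: "real (card {j\<in>{1..N}. \<not> (\<exists>f\<in>span B. \<forall>y\<in>P j. \<psi> x y = apply_bcontfun f y)}) \<le> b" for x
  proof -
    define J where "J = {j\<in>{1..N}. \<not> (\<exists>f\<in>span B. \<forall>y\<in>P j. \<psi> x y = apply_bcontfun f y)}"
    have "P j \<subseteq> (\<Union>i\<in>{1..<l}. shell x (t i - \<delta>) (t i + \<delta>))" if "j \<in> J" for j
    proof -
      have j: "j \<in> {1..N}" using that by (simp add: J_def)
      have "\<not> (\<exists>i\<in>{1..l}. P j \<subseteq> shell x (t (i - 1)) (t i))"
        using that exact unfolding J_def \<psi>_def by blast
      moreover have "(\<exists>i\<in>{1..l}. P j \<subseteq> shell x (t (i - 1)) (t i)) \<or>
          (\<exists>i\<in>{1..<l}. P j \<subseteq> shell x (t i - \<delta>) (t i + \<delta>))"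
        using dist_pi t_ends P_dist[OF j] by (intro subset_shell_cases[OF l]) auto
      ultimately show ?thesis by blast
    qed
    then have sub: "(\<Union>j\<in>J. P j) \<subseteq> (\<Union>i\<in>{1..<l}. shell x (t i - \<delta>) (t i + \<delta>))" by blast
    \<comment> \<open>Disjoint cells of equal mass are counted by the measure of their union, which
      lies in the shells around the interior breakpoints.\<close>
    have "real (card J) / real N = (\<Sum>j\<in>J. measure \<mu> (P j))"
      using P(2) by (simp add: J_def)
    also have "\<dots> = measure \<mu> (\<Union>j\<in>J. P j)"
      using P(1) by (intro finite_measure_finite_Union[symmetric])
        (auto simp: J_def measurable_partition_def disjoint_family_on_def)
    also have "\<dots> \<le> measure \<mu> (\<Union>i\<in>{1..<l}. shell x (t i - \<delta>) (t i + \<delta>))"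
      using shell_sets by (intro finite_measure_mono[OF sub] sets.finite_UN) auto
    also have "\<dots> \<le> (\<Sum>i\<in>{1..<l}. measure \<mu> (shell x (t i - \<delta>) (t i + \<delta>)))"
      using shell_sets by (intro finite_measure_subadditive_finite) auto
    also have "\<dots> \<le> (\<Sum>i\<in>{1..<l}. c2 * \<delta>)" by (intro sum_mono shell_measure)
    also have "\<dots> \<le> real l * (c2 * \<delta>)" using c2 \<delta> by (simp add: mult_right_mono)
    finally have "real (card J) \<le> b" using N by (simp add: b_def field_simps)
    then show ?thesis by (simp add: J_def)
  qed
  have "N \<ge> 1" using N by simp
  obtain u y where "\<And>j. 0 \<le> u j" "(\<Sum>j = 1..(card B + 2) * N. u j) = 1"
    "\<And>x. \<bar>(LINT y|\<mu>. \<psi> x y) - (\<Sum>j = 1..(card B + 2) * N. u j * \<psi> x (y j))\<bar>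
      \<le> 3 * \<eta> + \<delta> * sqrt (2 * b * ln (2 * real K)) / real N"
    by (rule sparse_quadrature[OF mu_prob int space Lip1 Lip2 B(1) \<open>N \<ge> 1\<close> K P(1,2) P_dist
      Q(1) Q_ne Q_dist \<delta> b bad]) (assumption | rule that)+
  moreover have "3 * \<eta> + \<delta> * sqrt (2 * b * ln (2 * real K)) / real N
    \<le> (8 * c1\<^sup>2 * sqrt (c2 * real l) * sqrt \<beta>)
       * real N powr (- 1 / 2 - 3 / (2 * \<beta>)) * sqrt (ln (real N))"
    unfolding \<eta>_def b_def \<delta>_def K_def by (rule rate_estimate[OF beta c1 c2 l N])
  ultimately show "\<exists>(y :: nat \<Rightarrow> 'a) (w :: nat \<Rightarrow> real).
      (\<forall>j\<in>{1..(r + 2) * N}. w j \<ge> 0) \<and> (\<Sum>j = 1..(r + 2) * N. w j) = 1 \<and>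
      (\<forall>x. \<bar>(LINT y'|\<mu>. \<Phi> (dist x y')) - (\<Sum>j = 1..(r + 2) * N. w j * \<Phi> (dist x (y j)))\<bar>
         \<le> (8 * c1\<^sup>2 * sqrt (c2 * real l) * sqrt \<beta>)
            * real N powr (- 1 / 2 - 3 / (2 * \<beta>)) * sqrt (ln (real N)))"
    unfolding \<psi>_def B(2) by (intro exI[of _ y] exI[of _ u] conjI ballI allI) (auto intro: order_trans)
qed

end
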